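(* Consider the multi-criteria problem with feasible set $S$ and real-valued criteria $F_1,\dots,F_n$ (each to be maximized or minimized), with best values $K_i$ and worst values $W_i$, and set $$\Delta(\vec X)=\sqrt{\sum_{i=1}^n[K_i-F_i(\vec X)]^2},\qquad \theta(\vec X)=\sqrt{\sum_{i=1}^n[W_i-F_i(\vec X)]^2}.$$ If $\vec X_{opt}\in S$ is an optimal solution of the single-criterion problem $$\gamma(\vec X)=\sqrt{\frac{\sum_{i=1}^n[K_i-F_i(\vec X)]^2}{\sum_{i=1}^n[W_i-F_i(\vec X)]^2}}\;\to\;\min\quad\text{over }\vec X\in S,$$ then $\vec X_{opt}$ is a Pareto-optimal solution of the two-criteria problem $\Delta(\vec X)\to\min$, $\theta(\vec X)\to\max$ over $\vec X\in S$; that is, there is no $\vec X'\in S$ with $\Delta(\vec X')\le\Delta(\vec X_{opt})$ and $\theta(\vec X')\ge\theta(\vec X_{opt})$ with at least one of these inequalities strict.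
   Context: Multi-criteria problem: vectors of variables are $\vec X=(x_1,\dots,x_m)$ with $x_k\in X_k$ for given sets $X_k$, subject to restrictions $\varphi_j(\vec X)\le b_j$ for all $j$, where the $\varphi_j$ are real-valued functions and the $b_j$ are real numbers. The feasible set $S$ is the set of all such $\vec X$ satisfying all restrictions. There are $n\ge 1$ real-valued criteria $F_i(\vec X)$, $i\in I=\{1,\dots,n\}$, and for each $i$ it is specified whether $F_i$ is to be maximized or minimized. Best and worst values: if $F_i$ is to be maximized, then $K_i=\max_{S}F_i$ and $W_i=\min_{S}F_i$; if $F_i$ is to be minimized, then $K_i=\min_{S}F_i$ and $W_i=\max_{S}F_i$. Standing assumptions: these extrema exist, and $K_i\ne W_i$ for every $i$. The points $(K_1,\dots,K_n)$ and $(W_1,\dots,W_n)$ of criteria space need not be attained by a feasible vector. Convention: $\gamma=\Delta/\theta$, and $\gamma(\vec X)=+\infty$ at any feasible $\vec X$ with $\theta(\vec X)=0$ (there $\Delta(\vec X)>0$ because $K_i\neq W_i$). *)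

theory Defs
  imports "HOL-Analysis.Analysis"
begin

text \<open>
  A vector $(x_1, \dots, x_m)$ is an element of the extensional product \<open>\<Pi>\<^sub>E k\<in>{1..m}. X k\<close>.
  The ground sets all live in one type \<open>'a\<close>, which is no restriction, as \<open>'a\<close> can be taken
  to be a disjoint union of the individual ground sets.
\<close>

definition feasible_set ::
  "nat \<Rightarrow> (nat \<Rightarrow> 'a set) \<Rightarrow> 'j set \<Rightarrow> ('j \<Rightarrow> (nat \<Rightarrow> 'a) \<Rightarrow> real) \<Rightarrow> ('j \<Rightarrow> real) \<Rightarrow> (nat \<Rightarrow> 'a) set"
  where "feasible_set m X J \<phi> b = {x \<in> (\<Pi>\<^sub>E k\<in>{1..m}. X k). \<forall>j\<in>J. \<phi> j x \<le> b j}"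

datatype direction = Maximize | Minimize

definition is_max_value :: "'x set \<Rightarrow> ('x \<Rightarrow> real) \<Rightarrow> real \<Rightarrow> bool"
  where "is_max_value S f v \<longleftrightarrow> (\<exists>x. is_arg_max f (\<lambda>x. x \<in> S) x \<and> v = f x)"

definition is_min_value :: "'x set \<Rightarrow> ('x \<Rightarrow> real) \<Rightarrow> real \<Rightarrow> bool"
  where "is_min_value S f v \<longleftrightarrow> (\<exists>x. is_arg_min f (\<lambda>x. x \<in> S) x \<and> v = f x)"

fun is_best_value :: "direction \<Rightarrow> 'x set \<Rightarrow> ('x \<Rightarrow> real) \<Rightarrow> real \<Rightarrow> bool"
  where
    "is_best_value Maximize S f v = is_max_value S f v"
  | "is_best_value Minimize S f v = is_min_value S f v"

fun is_worst_value :: "direction \<Rightarrow> 'x set \<Rightarrow> ('x \<Rightarrow> real) \<Rightarrow> real \<Rightarrow> bool"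
  where
    "is_worst_value Maximize S f v = is_min_value S f v"
  | "is_worst_value Minimize S f v = is_max_value S f v"

definition Delta :: "nat \<Rightarrow> (nat \<Rightarrow> real) \<Rightarrow> (nat \<Rightarrow> 'x \<Rightarrow> real) \<Rightarrow> 'x \<Rightarrow> real"
  where "Delta n K F x = sqrt (\<Sum>i=1..n. (K i - F i x)\<^sup>2)"

definition theta :: "nat \<Rightarrow> (nat \<Rightarrow> real) \<Rightarrow> (nat \<Rightarrow> 'x \<Rightarrow> real) \<Rightarrow> 'x \<Rightarrow> real"
  where "theta n W F x = sqrt (\<Sum>i=1..n. (W i - F i x)\<^sup>2)"

text \<open>
  The ratio is extended-real-valued: it is \<open>\<infinity>\<close> where the denominator vanishes, in contrast
  to the convention \<open>x / 0 = 0\<close> of real division.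
\<close>

definition gamma ::
  "nat \<Rightarrow> (nat \<Rightarrow> real) \<Rightarrow> (nat \<Rightarrow> real) \<Rightarrow> (nat \<Rightarrow> 'x \<Rightarrow> real) \<Rightarrow> 'x \<Rightarrow> ereal"
  where "gamma n K W F x =
    (if theta n W F x = 0 then \<infinity>
     else ereal (sqrt ((\<Sum>i=1..n. (K i - F i x)\<^sup>2) / (\<Sum>i=1..n. (W i - F i x)\<^sup>2))))"

definition pareto_optimal_min_max :: "'x set \<Rightarrow> ('x \<Rightarrow> real) \<Rightarrow> ('x \<Rightarrow> real) \<Rightarrow> 'x \<Rightarrow> bool"
  where "pareto_optimal_min_max S f g x \<longleftrightarrow>
    x \<in> S \<and> \<not> (\<exists>y\<in>S. f y \<le> f x \<and> g y \<ge> g x \<and> (f y < f x \<or> g y > g x))"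

end

theory Submission
  imports Defs
begin

text \<open>
  For \<open>\<theta> > 0\<close> the ratio \<open>\<Delta> / \<theta>\<close> is strictly increasing in \<open>\<Delta>\<close>, and for \<open>\<Delta> > 0\<close> also strictly
  decreasing in \<open>\<theta>\<close>. So if \<open>\<Delta>\<close> and \<open>\<theta>\<close> are positive at \<open>Xopt\<close>, a feasible point that dominates
  \<open>Xopt\<close> would have a smaller ratio than the minimum. Two boundary cases remain.

  If \<open>\<theta> Xopt = 0\<close>, the minimum of the ratio is \<open>\<infinity>\<close>, so \<open>\<theta>\<close> vanishes on all of \<open>S\<close>. Then every
  criterion is constantly \<open>W i\<close> on \<open>S\<close>, and its best value, being attained on \<open>S\<close>, equals \<open>W i\<close>,
  against \<open>K i \<noteq> W i\<close>.

  If \<open>\<Delta> Xopt = 0\<close>, the ratio is \<open>0\<close> at \<open>Xopt\<close> and need not drop at a dominating point. But such a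
  point also has \<open>\<Delta> = 0\<close>, so both points map to \<open>(K 1, \<dots>, K n)\<close> in criteria space;
  \<open>\<theta>\<close> depends only on the image there, and neither inequality can be strict.
\<close>

lemma Delta_nonneg: "0 \<le> Delta n K F x"
  by (simp add: Delta_def sum_nonneg)

lemma theta_nonneg: "0 \<le> theta n W F x"
  by (simp add: theta_def sum_nonneg)

lemma Delta_eq_0_iff: "Delta n K F x = 0 \<longleftrightarrow> (\<forall>i\<in>{1..n}. F i x = K i)"
  by (auto simp: Delta_def sum_nonneg_eq_0_iff)

lemma theta_eq_0_iff: "theta n W F x = 0 \<longleftrightarrow> (\<forall>i\<in>{1..n}. F i x = W i)"
  by (auto simp: theta_def sum_nonneg_eq_0_iff)

lemma theta_cong:
  assumes "\<And>i. i \<in> {1..n} \<Longrightarrow> F i x = F i y"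
  shows "theta n W F x = theta n W F y"
  unfolding theta_def using assms by simp

lemma gamma_eq_ratio:
  assumes "theta n W F x \<noteq> 0"
  shows "gamma n K W F x = ereal (Delta n K F x / theta n W F x)"
  using assms by (simp add: gamma_def Delta_def theta_def real_sqrt_divide)

lemma best_value_attained:
  assumes "is_best_value d S f v"
  obtains x where "x \<in> S" and "f x = v"
  using assms
  by (cases d) (auto simp: is_max_value_def is_min_value_def is_arg_max_def is_arg_min_def)

lemma ratio_strict_mono:
  fixes d d' t t' :: real
  assumes "0 < d" "0 < t" "d' \<le> d" "t \<le> t'" "d' < d \<or> t < t'"
  shows "d' / t' < d / t"
proof -
  have "d' * t < d * t'"
  proof (cases "d' < d")
    case True
    then have "d' * t < d * t" using assms by simp
    also have "d * t \<le> d * t'" using assms by simp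
    finally show ?thesis .
  next
    case False
    then show ?thesis using assms by simp
  qed
  then show ?thesis using assms by (simp add: divide_simps)
qed

text \<open>
  A minimizer of \<open>\<gamma>\<close> with value \<open>\<infinity>\<close> would force \<open>\<gamma> = \<infinity>\<close> throughout \<open>S\<close>; one criterion whose best value
  is attained and differs from the worst value excludes this.
\<close>

lemma theta_pos_at_gamma_minimizer:
  assumes i: "i \<in> {1..n}"
    and best: "is_best_value d S (F i) (K i)"
    and "K i \<noteq> W i"
    and opt: "is_arg_min (gamma n K W F) (\<lambda>x. x \<in> S) x"
  shows "0 < theta n W F x"
proof (rule ccontr)
  assume "\<not> 0 < theta n W F x"
  then have "gamma n K W F x = \<infinity>"
    using theta_nonneg[of n W F x] by (simp add: gamma_def)
  obtain y where "y \<in> S" and "F i y = K i"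
    using best by (rule best_value_attained)
  then have "theta n W F y \<noteq> 0"
    using i \<open>K i \<noteq> W i\<close> unfolding theta_eq_0_iff by metis
  then have "gamma n K W F y < gamma n K W F x"
    using \<open>gamma n K W F x = \<infinity>\<close> by (simp add: gamma_eq_ratio)
  then show False
    using opt \<open>y \<in> S\<close> by (auto simp: is_arg_min_def)
qed

theorem theorem4:
  fixes m n :: nat
    and X :: "nat \<Rightarrow> 'a set"
    and J :: "'j set"
    and \<phi> :: "'j \<Rightarrow> (nat \<Rightarrow> 'a) \<Rightarrow> real"
    and b :: "'j \<Rightarrow> real"
    and F :: "nat \<Rightarrow> (nat \<Rightarrow> 'a) \<Rightarrow> real"
    and dir :: "nat \<Rightarrow> direction"
    and K W :: "nat \<Rightarrow> real"
    and S :: "(nat \<Rightarrow> 'a) set"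
    and Xopt :: "nat \<Rightarrow> 'a"
  assumes "n \<ge> 1"
    and "S = feasible_set m X J \<phi> b"
    and "\<And>i. i \<in> {1..n} \<Longrightarrow> is_best_value (dir i) S (F i) (K i)"
    and "\<And>i. i \<in> {1..n} \<Longrightarrow> is_worst_value (dir i) S (F i) (W i)"
    and "\<And>i. i \<in> {1..n} \<Longrightarrow> K i \<noteq> W i"
    and "is_arg_min (gamma n K W F) (\<lambda>x. x \<in> S) Xopt"
  shows "pareto_optimal_min_max S (Delta n K F) (theta n W F) Xopt"
proof -
  have "Xopt \<in> S" and least: "\<And>y. y \<in> S \<Longrightarrow> \<not> gamma n K W F y < gamma n K W F Xopt"
    using assms(6) by (auto simp: is_arg_min_def)
  have one: "1 \<in> {1..n}"
    using assms(1) by simp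
  have pos: "0 < theta n W F Xopt"
    by (rule theta_pos_at_gamma_minimizer[OF one assms(3)[OF one] assms(5)[OF one] assms(6)])
  have False
    if "y \<in> S"
      and le: "Delta n K F y \<le> Delta n K F Xopt"
      and ge: "theta n W F Xopt \<le> theta n W F y"
      and strict: "Delta n K F y < Delta n K F Xopt \<or> theta n W F Xopt < theta n W F y"
    for y
  proof (cases "Delta n K F Xopt = 0")
    case True
    then have "Delta n K F y = 0"
      using le Delta_nonneg[of n K F y] by simp
    with True have "theta n W F y = theta n W F Xopt"
      by (intro theta_cong) (simp add: Delta_eq_0_iff)
    then show False
      using strict True \<open>Delta n K F y = 0\<close> by simp
  next
    case False
    then have "0 < Delta n K F Xopt"
      using Delta_nonneg[of n K F Xopt] by simp
    then have "Delta n K F y / theta n W F y < Delta n K F Xopt / theta n W F Xopt"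
      using pos le ge strict by (rule ratio_strict_mono)
    then have "gamma n K W F y < gamma n K W F Xopt"
      using pos ge by (simp add: gamma_eq_ratio)
    then show False
      using least \<open>y \<in> S\<close> by blast
  qed
  then show ?thesis
    unfolding pareto_optimal_min_max_def using \<open>Xopt \<in> S\<close> by blast
qed

end
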